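(* Let $n$ be a positive integer. The following are equivalent: (a) there exists an $n\times n$ Hadamard matrix; (b) there is a connected simple graph on $n$ vertices with $\{-1,1\}$-bandwidth $1$; (c) the complete graph $K_n$ has $\{-1,1\}$-bandwidth $1$.
   Context: A Hadamard matrix is a square matrix with entries in $\{-1,1\}$ whose columns are mutually orthogonal. For a simple graph with adjacency matrix $A$ and degree matrix $D$, the Laplacian is $L=D-A$. The bandwidth of a square matrix $M$ is the smallest positive integer $k$ with $m_{i,j}=0$ whenever $|i-j|\ge k$. The $\{-1,1\}$-bandwidth of a graph is $\infty$ if there is no invertible matrix with entries in $\{-1,1\}$ diagonalizing $L$, and otherwise the smallest positive integer $k$ for which there is a matrix $P$ with entries in $\{-1,1\}$, $P^{-1}LP$ diagonal, and $P^TP$ of bandwidth $k$. *)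

theory Defs
  imports
    "HOL-Library.Extended_Nat"
    "Jordan_Normal_Form.Matrix"
    "Graph_Theory.Graph_Theory"
begin

definition sign_mat :: "real mat \<Rightarrow> bool" where
  "sign_mat M \<longleftrightarrow> elements_mat M \<subseteq> {-1, 1}"

definition hadamard_mat :: "nat \<Rightarrow> real mat \<Rightarrow> bool" where
  "hadamard_mat n H \<longleftrightarrow>
     H \<in> carrier_mat n n \<and> sign_mat H \<and>
     (\<forall>i < n. \<forall>j < n. i \<noteq> j \<longrightarrow> col H i \<bullet> col H j = 0)"

definition bandwidth :: "real mat \<Rightarrow> nat" where
  "bandwidth M =
     (LEAST k. 0 < k \<and>
        (\<forall>i < dim_row M. \<forall>j < dim_col M. int k \<le> \<bar>int i - int j\<bar> \<longrightarrow> M $$ (i, j) = 0))"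

text \<open>
  A simple graph is a \<^locale>\<open>pair_graph\<close>: a finite, loop-free, symmetric set of arcs, each edge
  being represented by its two opposite arcs. The matrices below are meant for graphs whose
  vertex set is an initial segment \<open>{..<n}\<close> of the natural numbers, so that the vertices serve
  directly as row and column indices. The degree of a vertex is its \<^const>\<open>out_degree\<close>.
\<close>

definition adjacency_mat :: "nat pair_pre_digraph \<Rightarrow> real mat" where
  "adjacency_mat G =
     mat (card (pverts G)) (card (pverts G)) (\<lambda>(i, j). if (i, j) \<in> parcs G then 1 else 0)"

definition degree_mat :: "nat pair_pre_digraph \<Rightarrow> real mat" where
  "degree_mat G =
     mat_diag (card (pverts G)) (\<lambda>i. real (out_degree (with_proj G) i))"

definition laplacian :: "nat pair_pre_digraph \<Rightarrow> real mat" where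
  "laplacian G = degree_mat G - adjacency_mat G"

definition diagonalizes :: "real mat \<Rightarrow> real mat \<Rightarrow> bool" where
  "diagonalizes P L \<longleftrightarrow>
     P \<in> carrier_mat (dim_row L) (dim_row L) \<and>
     (\<exists>Q. inverts_mat P Q \<and> inverts_mat Q P \<and> diagonal_mat (Q * L * P))"

definition sign_bandwidth :: "nat pair_pre_digraph \<Rightarrow> enat" where
  "sign_bandwidth G =
     (if \<exists>P. sign_mat P \<and> diagonalizes P (laplacian G)
      then enat (LEAST k. 0 < k \<and>
             (\<exists>P. sign_mat P \<and> diagonalizes P (laplacian G) \<and>
                  bandwidth (transpose_mat P * P) = k))
      else \<infinity>)"

definition complete_graph :: "nat \<Rightarrow> nat pair_pre_digraph" where
  "complete_graph n = \<lparr>pverts = {..<n}, parcs = {(i, j). i < n \<and> j < n \<and> i \<noteq> j}\<rparr>"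

lemma pair_graph_complete_graph: "pair_graph (complete_graph n)"
proof -
  have "finite {(i, j). i < n \<and> j < n \<and> i \<noteq> j}"
    by (rule finite_subset[of _ "{..<n} \<times> {..<n}"]) auto
  then show ?thesis
    by unfold_locales (auto simp: complete_graph_def symmetric_def sym_def)
qed

lemma complete_digraph_complete_graph: "complete_digraph n (with_proj (complete_graph n))"
  using pair_graph.pair_graphD_graph[OF pair_graph_complete_graph, of n]
  by (auto simp: complete_digraph_def complete_graph_def)

end

theory Submission
  imports Defs "Jordan_Normal_Form.Determinant"
begin

text \<open>
  If \<open>P\<close> realises \<open>{-1,1}\<close>-bandwidth \<open>1\<close>, then \<open>P\<^sup>T P\<close> is diagonal, so \<open>P\<close> is Hadamard.
  Conversely, negating rows of a Hadamard matrix
  preserves column orthogonality, so its first column may be assumed to be the all-ones vector.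
  The other columns then sum to zero, whence all columns are eigenvectors of \<open>n I - J\<close>, the
  Laplacian of the complete graph.
\<close>

lemma sign_mat_iff:
  assumes "M \<in> carrier_mat m n"
  shows "sign_mat M \<longleftrightarrow> (\<forall>i < m. \<forall>j < n. M $$ (i, j) = -1 \<or> M $$ (i, j) = 1)"
proof
  assume "sign_mat M"
  then have "M $$ (i, j) \<in> {-1, 1}" if "i < m" "j < n" for i j
    using elements_matI[OF assms that refl] unfolding sign_mat_def by blast
  then show "\<forall>i < m. \<forall>j < n. M $$ (i, j) = -1 \<or> M $$ (i, j) = 1"
    by simp
next
  assume "\<forall>i < m. \<forall>j < n. M $$ (i, j) = -1 \<or> M $$ (i, j) = 1"
  then show "sign_mat M"
    using assms unfolding sign_mat_def by (auto dest!: elements_matD)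
qed

text \<open>The condition under \<open>LEAST\<close> holds vacuously once \<open>k\<close> exceeds
  every index difference, so the least value exists and itself satisfies the condition.\<close>

lemma bandwidth_witness:
  "0 < bandwidth M \<and>
    (\<forall>i < dim_row M. \<forall>j < dim_col M. int (bandwidth M) \<le> \<bar>int i - int j\<bar> \<longrightarrow> M $$ (i, j) = 0)"
  unfolding bandwidth_def
  by (rule LeastI[where k = "dim_row M + dim_col M + 1"]) auto

lemma bandwidth_eq_1_iff: "bandwidth M = 1 \<longleftrightarrow> diagonal_mat M"
proof
  assume "bandwidth M = 1"
  then show "diagonal_mat M"
    using bandwidth_witness[of M] unfolding diagonal_mat_def by auto
next
  assume "diagonal_mat M"
  then have "bandwidth M \<le> 1"
    unfolding bandwidth_def diagonal_mat_def by (intro Least_le) auto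
  then show "bandwidth M = 1"
    using bandwidth_witness[of M] by linarith
qed

text \<open>Positivity makes 1 the smallest conceivable value, so the minimum equals 1 exactly when
  1 is attained. This removes both \<open>LEAST\<close> and the infinite case.\<close>

lemma sign_bandwidth_eq_1_iff:
  "sign_bandwidth G = 1 \<longleftrightarrow>
    (\<exists>P. sign_mat P \<and> diagonalizes P (laplacian G) \<and> diagonal_mat (transpose_mat P * P))"
proof -
  define realizes where "realizes k \<longleftrightarrow> 0 < k \<and>
    (\<exists>P. sign_mat P \<and> diagonalizes P (laplacian G) \<and> bandwidth (transpose_mat P * P) = k)" for k
  have sb: "sign_bandwidth G =
    (if \<exists>P. sign_mat P \<and> diagonalizes P (laplacian G) then enat (LEAST k. realizes k) else \<infinity>)"
    unfolding sign_bandwidth_def realizes_def ..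
  \<comment> \<open>The bandwidth of \<open>transpose_mat P * P\<close> is itself an admissible
    \<open>k\<close>, so \<open>LEAST\<close> ranges over a nonempty set whenever the value is
    finite.\<close>
  have ex: "\<exists>k. realizes k" if "sign_mat P" "diagonalizes P (laplacian G)" for P
    using that bandwidth_witness unfolding realizes_def by blast
  have "sign_bandwidth G = 1 \<longleftrightarrow> realizes 1"
  proof
    assume "sign_bandwidth G = 1"
    then have "\<exists>P. sign_mat P \<and> diagonalizes P (laplacian G)" and "(LEAST k. realizes k) = 1"
      unfolding sb by (auto simp: one_enat_def split: if_splits)
    then show "realizes 1"
      using ex LeastI_ex[of realizes] by auto
  next
    assume "realizes 1"
    then have "(LEAST k. realizes k) = 1"
      by (rule Least_equality) (simp add: realizes_def)
    then show "sign_bandwidth G = 1"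
      using \<open>realizes 1\<close> unfolding sb realizes_def by (auto simp: one_enat_def)
  qed
  then show ?thesis
    unfolding realizes_def bandwidth_eq_1_iff by simp
qed

lemma laplacian_carrier: "laplacian G \<in> carrier_mat (card (pverts G)) (card (pverts G))"
  unfolding laplacian_def adjacency_mat_def degree_mat_def by auto

text \<open>The entries of \<open>transpose_mat P * P\<close> are the inner products of the columns
  of \<open>P\<close>.\<close>

lemma hadamard_mat_iff:
  assumes "P \<in> carrier_mat n n"
  shows "hadamard_mat n P \<longleftrightarrow> sign_mat P \<and> diagonal_mat (transpose_mat P * P)"
  using assms unfolding hadamard_mat_def diagonal_mat_def by auto

lemma hadamard_mat_of_sign_bandwidth:
  assumes "sign_bandwidth G = 1"
  shows "\<exists>H. hadamard_mat (card (pverts G)) H"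
proof -
  obtain P where P: "sign_mat P" "diagonalizes P (laplacian G)" "diagonal_mat (transpose_mat P * P)"
    using assms unfolding sign_bandwidth_eq_1_iff by blast
  have "P \<in> carrier_mat (card (pverts G)) (card (pverts G))"
    using P(2) laplacian_carrier[of G] unfolding diagonalizes_def by simp
  then show ?thesis
    using P hadamard_mat_iff by blast
qed

text \<open>Each diagonal entry is a sum of \<open>n\<close> squares of signs. The identity later
  supplies both the column sums and the inverse of \<open>H\<close>.\<close>

lemma hadamard_mat_transpose_mult:
  assumes "hadamard_mat n H"
  shows "transpose_mat H * H = real n \<cdot>\<^sub>m 1\<^sub>m n"
proof (rule eq_matI)
  have H: "H \<in> carrier_mat n n"
    using assms unfolding hadamard_mat_def by blast
  fix i j assume "i < dim_row (real n \<cdot>\<^sub>m 1\<^sub>m n)" "j < dim_col (real n \<cdot>\<^sub>m 1\<^sub>m n)"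
  then have ij: "i < n" "j < n"
    by auto
  have "H $$ (k, i) * H $$ (k, i) = 1" if "k < n" for k
    using assms that ij sign_mat_iff[OF H] unfolding hadamard_mat_def by fastforce
  then have "col H i \<bullet> col H i = (\<Sum>k = 0..<n. 1)"
    using H ij unfolding scalar_prod_def by (intro sum.cong) auto
  then show "(transpose_mat H * H) $$ (i, j) = (real n \<cdot>\<^sub>m 1\<^sub>m n) $$ (i, j)"
    using assms H ij unfolding hadamard_mat_def by auto
qed (use assms in \<open>auto simp: hadamard_mat_def\<close>)

lemma hadamard_mat_normalize:
  assumes "hadamard_mat n H" and "0 < n"
  shows "\<exists>H'. hadamard_mat n H' \<and> (\<forall>i < n. H' $$ (i, 0) = 1)"
proof -
  \<comment> \<open>Row \<open>i\<close> is scaled by its own leading sign. Column 0 then consists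
    of squares, and in a product of two entries of one row the sign occurs twice and
    cancels.\<close>
  define H' where "H' = mat n n (\<lambda>(i, j). H $$ (i, 0) * H $$ (i, j))"
  have H: "H \<in> carrier_mat n n" and H': "H' \<in> carrier_mat n n"
    using assms unfolding hadamard_mat_def H'_def by auto
  have sgn: "H $$ (i, j) = -1 \<or> H $$ (i, j) = 1" if "i < n" "j < n" for i j
    using assms that sign_mat_iff[OF H] unfolding hadamard_mat_def by blast
  have sq: "H $$ (i, 0) * H $$ (i, 0) = 1" if "i < n" for i
    using sgn[OF that \<open>0 < n\<close>] by auto
  have "H' $$ (i, j) = -1 \<or> H' $$ (i, j) = 1" if "i < n" "j < n" for i j
    using sgn[OF that] sgn[OF that(1) \<open>0 < n\<close>] that by (auto simp: H'_def)
  then have "sign_mat H'"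
    unfolding sign_mat_iff[OF H'] by blast
  moreover have "col H' i \<bullet> col H' j = col H i \<bullet> col H j" if "i < n" "j < n" for i j
  proof -
    have "H' $$ (k, i) * H' $$ (k, j) = H $$ (k, i) * H $$ (k, j)" if "k < n" for k
    proof -
      have "H' $$ (k, i) * H' $$ (k, j) =
          (H $$ (k, 0) * H $$ (k, 0)) * (H $$ (k, i) * H $$ (k, j))"
        using that \<open>i < n\<close> \<open>j < n\<close> by (simp add: H'_def ac_simps)
      then show ?thesis
        using sq[OF that] by simp
    qed
    then show ?thesis
      using that H H' unfolding scalar_prod_def by (intro sum.cong) auto
  qed
  ultimately have "hadamard_mat n H'"
    using assms H' unfolding hadamard_mat_def by auto
  then show ?thesis
    using sq \<open>0 < n\<close> by (auto simp: H'_def)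
qed

lemma laplacian_complete_graph:
  "laplacian (complete_graph n) = mat n n (\<lambda>(i, j). (if i = j then real n else 0) - 1)"
proof -
  have "out_degree (with_proj (complete_graph n)) i = n - 1" if "i < n" for i
  proof -
    have "out_arcs (with_proj (complete_graph n)) i = Pair i ` ({..<n} - {i})"
      using that by (auto simp: out_arcs_def complete_graph_def)
    then show ?thesis
      using that by (simp add: out_degree_def card_image inj_on_def)
  qed
  then show ?thesis
    unfolding laplacian_def degree_mat_def adjacency_mat_def mat_diag_def
    by (intro eq_matI) (auto simp: complete_graph_def of_nat_diff)
qed

text \<open>Right multiplication by a diagonal matrix scales columns, so this collects the
  eigenvalue equations: the all-ones column 0 has eigenvalue 0, every other column has eigenvalue
  \<open>n\<close>.\<close>

lemma laplacian_complete_graph_mult: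
  assumes "hadamard_mat n H" and "\<And>i. i < n \<Longrightarrow> H $$ (i, 0) = 1"
  shows "laplacian (complete_graph n) * H = H * mat_diag n (\<lambda>j. if j = 0 then 0 else real n)"
proof -
  have H: "H \<in> carrier_mat n n"
    using assms unfolding hadamard_mat_def by blast
  have colsum: "(\<Sum>k = 0..<n. H $$ (k, j)) = (if j = 0 then real n else 0)" if "j < n" for j
  proof -
    \<comment> \<open>Column 0 is all ones, so a column sum is an inner product with it.\<close>
    have "(\<Sum>k = 0..<n. H $$ (k, j)) = col H 0 \<bullet> col H j"
      using H that assms(2) unfolding scalar_prod_def by (intro sum.cong) auto
    also have "\<dots> = (transpose_mat H * H) $$ (0, j)"
      using H that by simp
    finally show ?thesis
      unfolding hadamard_mat_transpose_mult[OF assms(1)] using that by auto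
  qed
  show ?thesis
  proof (rule eq_matI)
    fix i j assume "i < dim_row (H * mat_diag n (\<lambda>j. if j = 0 then 0 else real n))"
      and "j < dim_col (H * mat_diag n (\<lambda>j. if j = 0 then 0 else real n))"
    then have ij: "i < n" "j < n"
      using H by (auto simp: mat_diag_def)
    have "(laplacian (complete_graph n) * H) $$ (i, j) =
        (\<Sum>k = 0..<n. ((if i = k then real n else 0) - 1) * H $$ (k, j))"
      using H ij unfolding laplacian_complete_graph by (simp add: scalar_prod_def)
    also have "\<dots> = (\<Sum>k = 0..<n. (if i = k then real n * H $$ (k, j) else 0) - H $$ (k, j))"
      by (intro sum.cong) (auto simp: algebra_simps)
    also have "\<dots> = real n * H $$ (i, j) - (\<Sum>k = 0..<n. H $$ (k, j))"
      using ij by (simp add: sum_subtractf)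
    \<comment> \<open>For \<open>j = 0\<close> the entry is 1 and the column sum \<open>n\<close>
      cancels the first term; for other \<open>j\<close> the column sum vanishes.\<close>
    also have "\<dots> = H $$ (i, j) * (if j = 0 then 0 else real n)"
      using ij assms(2) by (simp add: colsum)
    finally show "(laplacian (complete_graph n) * H) $$ (i, j) =
        (H * mat_diag n (\<lambda>j. if j = 0 then 0 else real n)) $$ (i, j)"
      using ij by (simp add: mat_diag_mult_right[OF H])
  qed (use H in \<open>auto simp: laplacian_complete_graph mat_diag_def\<close>)
qed

lemma sign_bandwidth_complete_graph:
  assumes "hadamard_mat n H" and "0 < n"
  shows "sign_bandwidth (complete_graph n) = 1"
proof -
  obtain P where P: "hadamard_mat n P" and ones: "\<And>i. i < n \<Longrightarrow> P $$ (i, 0) = 1"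
    using hadamard_mat_normalize[OF assms] by blast
  define L where "L = laplacian (complete_graph n)"
  define D where "D = mat_diag n (\<lambda>j. if j = 0 then 0 else real n)"
  define Q where "Q = (1 / real n) \<cdot>\<^sub>m transpose_mat P"
  have carr: "P \<in> carrier_mat n n" "Q \<in> carrier_mat n n" "L \<in> carrier_mat n n" "D \<in> carrier_mat n n"
    using P by (auto simp: hadamard_mat_def Q_def L_def D_def laplacian_complete_graph)
  have "Q * P = (1 / real n) \<cdot>\<^sub>m (transpose_mat P * P)"
    unfolding Q_def using carr(1) by (intro mult_smult_assoc_mat) auto
  also have "\<dots> = 1\<^sub>m n"
    unfolding hadamard_mat_transpose_mult[OF P] using assms(2) by (intro eq_matI) auto
  finally have QP: "Q * P = 1\<^sub>m n" .
  \<comment> \<open>For square matrices over a field a left inverse is also a right inverse.\<close>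
  have PQ: "P * Q = 1\<^sub>m n"
    by (rule mat_mult_left_right_inverse[OF carr(2,1) QP])
  have "Q * L * P = Q * (L * P)"
    by (rule assoc_mult_mat[OF carr(2,3,1)])
  also have "\<dots> = Q * (P * D)"
    using laplacian_complete_graph_mult[OF P ones] unfolding L_def D_def by simp
  also have "\<dots> = Q * P * D"
    by (rule assoc_mult_mat[OF carr(2,1,4), symmetric])
  also have "\<dots> = D"
    unfolding QP using carr(4) by simp
  finally have "diagonal_mat (Q * L * P)"
    by (simp add: D_def diagonal_mat_def mat_diag_def)
  then have "diagonalizes P L"
    using carr PQ QP unfolding diagonalizes_def inverts_mat_def by auto
  then show ?thesis
    using P carr(1) unfolding sign_bandwidth_eq_1_iff L_def by (auto simp: hadamard_mat_iff)
qed

lemma connected_complete_graph: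
  assumes "0 < n"
  shows "Digraph_Component.connected (with_proj (complete_graph n))"
proof -
  interpret pair_graph "complete_graph n"
    by (rule pair_graph_complete_graph)
  have "u \<rightarrow>\<^sup>*\<^bsub>with_proj (complete_graph n)\<^esub> v" if "u < n" "v < n" for u v
  proof (cases "u = v")
    case True
    then show ?thesis
      using that reachable_refl[of v] by (simp add: complete_graph_def)
  next
    case False
    then show ?thesis
      using that by (intro reachable_adjI) (auto simp: complete_graph_def)
  qed
  then show ?thesis
    \<comment> \<open>Connectedness means strong connectedness of the symmetric closure, which
      includes having a vertex, hence \<open>0 < n\<close>; reachability carries over to the
      closure.\<close>
    using assms unfolding connected_def strongly_connected_def
    by (auto simp: complete_graph_def intro: reachable_mk_symmetricI[unfolded complete_graph_def])
qed

theorem theorem4p4: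
  fixes n :: nat
  assumes "0 < n"
  shows "((\<exists>H. hadamard_mat n H) \<longleftrightarrow>
          (\<exists>G. pair_graph G \<and> pverts G = {..<n} \<and>
               Digraph_Component.connected (with_proj G) \<and> sign_bandwidth G = 1)) \<and>
         ((\<exists>G. pair_graph G \<and> pverts G = {..<n} \<and>
               Digraph_Component.connected (with_proj G) \<and> sign_bandwidth G = 1) \<longleftrightarrow>
          sign_bandwidth (complete_graph n) = 1)"
proof -
  let ?b = "\<exists>G. pair_graph G \<and> pverts G = {..<n} \<and>
    Digraph_Component.connected (with_proj G) \<and> sign_bandwidth G = 1"
  \<comment> \<open>The equivalences are closed in the cycle (a) to (c) to (b) to (a).\<close>
  have "sign_bandwidth (complete_graph n) = 1" if "\<exists>H. hadamard_mat n H"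
    using that sign_bandwidth_complete_graph assms by blast
  moreover have ?b if "sign_bandwidth (complete_graph n) = 1"
    using that pair_graph_complete_graph connected_complete_graph[OF assms]
    by (intro exI[of _ "complete_graph n"]) (simp add: complete_graph_def)
  moreover have "\<exists>H. hadamard_mat n H" if ?b
    using that hadamard_mat_of_sign_bandwidth by fastforce
  ultimately show ?thesis
    by blast
qed

end
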